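(* Let $G$ be a graph with complement $\bar{G}$. Then at least one of the graphs $H = G$ or $H = \bar{G}$ satisfies \[\chi(H) \leq \tfrac{1}{4}\omega(H) + \tfrac{3}{4}\Delta(H) + 1.\]
   Context: Graphs are finite and simple. For a graph $H$, $\chi(H)$ is the chromatic number, $\omega(H)$ the clique number (maximum order of a clique), and $\Delta(H)$ the maximum degree. The complement $\bar{G}$ has the same vertex set as $G$, with two distinct vertices adjacent in $\bar{G}$ if and only if they are non-adjacent in $G$. *)

theory Defs
  imports Complex_Main
begin

text \<open>A graph is given by its vertex set \<open>V\<close> and its adjacency relation \<open>E\<close>.\<close>

definition simple_graph :: "'a set \<Rightarrow> ('a \<Rightarrow> 'a \<Rightarrow> bool) \<Rightarrow> bool" where
  "simple_graph V E \<longleftrightarrow>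
     finite V \<and>
     (\<forall>u v. E u v \<longrightarrow> u \<in> V \<and> v \<in> V) \<and>
     (\<forall>u v. E u v \<longrightarrow> E v u) \<and>
     (\<forall>v. \<not> E v v)"

definition complement :: "'a set \<Rightarrow> ('a \<Rightarrow> 'a \<Rightarrow> bool) \<Rightarrow> 'a \<Rightarrow> 'a \<Rightarrow> bool" where
  "complement V E u v \<longleftrightarrow> u \<in> V \<and> v \<in> V \<and> u \<noteq> v \<and> \<not> E u v"

definition proper_colouring ::
    "'a set \<Rightarrow> ('a \<Rightarrow> 'a \<Rightarrow> bool) \<Rightarrow> nat \<Rightarrow> ('a \<Rightarrow> nat) \<Rightarrow> bool" where
  "proper_colouring V E k c \<longleftrightarrow>
     (\<forall>v\<in>V. c v < k) \<and> (\<forall>u\<in>V. \<forall>v\<in>V. E u v \<longrightarrow> c u \<noteq> c v)"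

definition chromatic_number :: "'a set \<Rightarrow> ('a \<Rightarrow> 'a \<Rightarrow> bool) \<Rightarrow> nat" where
  "chromatic_number V E = (LEAST k. \<exists>c. proper_colouring V E k c)"

definition clique :: "'a set \<Rightarrow> ('a \<Rightarrow> 'a \<Rightarrow> bool) \<Rightarrow> 'a set \<Rightarrow> bool" where
  "clique V E K \<longleftrightarrow> K \<subseteq> V \<and> (\<forall>u\<in>K. \<forall>v\<in>K. u \<noteq> v \<longrightarrow> E u v)"

definition clique_number :: "'a set \<Rightarrow> ('a \<Rightarrow> 'a \<Rightarrow> bool) \<Rightarrow> nat" where
  "clique_number V E = Max {card K | K. clique V E K}"

definition degree :: "'a set \<Rightarrow> ('a \<Rightarrow> 'a \<Rightarrow> bool) \<Rightarrow> 'a \<Rightarrow> nat" where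
  "degree V E v = card {u \<in> V. E v u}"

text \<open>Inserting \<open>0\<close> only matters for the graph without vertices, whose maximum
  degree is taken to be \<open>0\<close>; \<open>Max\<close> of the empty set is unspecified.\<close>

definition max_degree :: "'a set \<Rightarrow> ('a \<Rightarrow> 'a \<Rightarrow> bool) \<Rightarrow> nat" where
  "max_degree V E = Max (insert 0 (degree V E ` V))"

lemma simple_graph_complement:
  "simple_graph V E \<Longrightarrow> simple_graph V (complement V E)"
  by (auto simp: simple_graph_def complement_def)

lemma chromatic_number_colouring:
  fixes V :: "'a set" and E :: "'a \<Rightarrow> 'a \<Rightarrow> bool"
  assumes "simple_graph V E"
  shows "\<exists>c. proper_colouring V E (chromatic_number V E) c"
proof -
  have "finite V" and irr: "\<And>v. \<not> E v v"
    using assms by (auto simp: simple_graph_def)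
  obtain c :: "'a \<Rightarrow> nat" and n where c: "c ` V = {i. i < n}" "inj_on c V"
    using finite_imp_inj_to_nat_seg[OF \<open>finite V\<close>] by blast
  have "c v < n" if "v \<in> V" for v
    using c(1) imageI[OF that, of c] by simp
  moreover have "c u \<noteq> c v" if "u \<in> V" "v \<in> V" "E u v" for u v
    using inj_onD[OF c(2) _ that(1,2)] that(3) irr[of u] by auto
  ultimately have "proper_colouring V E n c"
    unfolding proper_colouring_def by simp
  then have "\<exists>c. proper_colouring V E n c"
    by (rule exI[of "proper_colouring V E n" c])
  then show ?thesis
    unfolding chromatic_number_def by (rule LeastI)
qed

lemma clique_sizes_finite_nonempty:
  fixes V :: "'a set" and E :: "'a \<Rightarrow> 'a \<Rightarrow> bool"
  assumes "simple_graph V E"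
  shows "finite {card K | K. clique V E K}" and "{card K | K. clique V E K} \<noteq> {}"
proof -
  have "finite V" using assms by (simp add: simple_graph_def)
  then have "finite (card ` Pow V)" by simp
  then show "finite {card K | K. clique V E K}"
    by (rule finite_subset[rotated]) (auto simp: clique_def)
  have "clique V E {}" by (simp add: clique_def)
  then show "{card K | K. clique V E K} \<noteq> {}" by blast
qed

end

theory Submission
  imports Defs "HOL-Library.Disjoint_Sets" "HOL-Combinatorics.Transposition"
begin

text \<open>
  A colouring is regarded as a partition \<open>P\<close> of \<open>V\<close> into stable sets, and its surplus is the sum
  of \<open>\<bar>S\<bar> - 2\<close> over the classes \<open>S\<close> with at least two vertices. If \<open>P\<close> has at most one singleton
  class, then \<open>2 * \<bar>P\<bar> + surplus P \<le> \<bar>V\<bar> + 1\<close>, so a large surplus makes \<open>P\<close> an economical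
  colouring.

  Singletons are controlled by an exchange argument. Fix a lower bound \<open>m\<close> for the surplus and let
  \<open>P\<close> have the fewest classes subject to it. No two classes can then be merged. If the singleton
  \<open>v\<close> has exactly one neighbour \<open>w\<close> in a class \<open>I\<close>, exchanging \<open>v\<close> and \<open>w\<close> preserves all class
  sizes, so the new partition is extremal too, and \<open>w\<close>, now a singleton, has a neighbour in every
  other class. With two singletons \<open>u\<close> and \<open>v\<close> this has two consequences: the unique neighbours in
  the classes where both have only one neighbour coincide, and together with \<open>u\<close> and \<open>v\<close> they form
  a clique; in each remaining class other than \<open>{u}\<close> and \<open>{v}\<close>, one of \<open>u\<close> and \<open>v\<close> has at least
  two neighbours, which makes the maximum degree large. Adding the two estimates gives
  \<open>4 * \<chi> \<le> \<omega> + 3 * \<Delta> + 4\<close>, the desired bound (\<open>two_singletons_bound\<close>).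

  Hence, if the bound fails for both graphs, \<open>2 * \<chi> + s \<le> n + 1\<close> holds for each of them, where \<open>s\<close>
  is the surplus of any partition of \<open>V\<close> into stable sets of that graph and \<open>n = \<bar>V\<bar>\<close>. As the two
  maximum degrees sum to at least \<open>n - 1\<close>, this forces \<open>2 * (s + s') + \<omega> + \<omega>' \<le> n - 3\<close>. That
  contradicts a Ramsey argument (\<open>well_packed\<close>): removing cliques and stable sets of size four, each
  worth its four vertices, and then treating the remaining graphs with the bounds
  \<open>R(3,3) \<le> 6\<close> and \<open>R(3,4) \<le> 10\<close>, one finds partitions with
  \<open>n \<le> 2 * (s + s') + \<omega> + \<omega>' + 2\<close>.
\<close>

section \<open>Partitions into stable sets\<close>

definition stable_set :: "('a \<Rightarrow> 'a \<Rightarrow> bool) \<Rightarrow> 'a set \<Rightarrow> bool" where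
  "stable_set E S \<longleftrightarrow> (\<forall>x\<in>S. \<forall>y\<in>S. \<not> E x y)"

definition stable_partition :: "'a set \<Rightarrow> ('a \<Rightarrow> 'a \<Rightarrow> bool) \<Rightarrow> 'a set set \<Rightarrow> bool" where
  "stable_partition V E P \<longleftrightarrow> partition_on V P \<and> (\<forall>S\<in>P. stable_set E S)"

text \<open>Truncated subtraction lets singleton classes count zero rather than \<open>-1\<close>, so completing a
  family of disjoint stable sets by singletons does not change its surplus.\<close>

definition surplus :: "'a set set \<Rightarrow> nat" where
  "surplus P = (\<Sum>S\<in>P. card S - 2)"

lemma stable_partitionD:
  assumes "stable_partition V E P"
  shows "\<Union>P = V" "{} \<notin> P" "\<And>S. S \<in> P \<Longrightarrow> stable_set E S"
    "\<And>S T x. S \<in> P \<Longrightarrow> T \<in> P \<Longrightarrow> x \<in> S \<Longrightarrow> x \<in> T \<Longrightarrow> S = T"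
  using assms by (auto simp: stable_partition_def partition_on_def disjoint_def)

lemma stable_partition_finite:
  assumes "finite V" "stable_partition V E P"
  shows "finite P" "\<And>S. S \<in> P \<Longrightarrow> finite S"
proof -
  have "\<Union>P = V" by (rule stable_partitionD[OF assms(2)])
  then show "finite P" "\<And>S. S \<in> P \<Longrightarrow> finite S"
    using assms(1) by (auto intro: finite_UnionD finite_subset)
qed

lemma stable_partition_singletons:
  assumes "\<And>x. \<not> E x x"
  shows "stable_partition V E ((\<lambda>x. {x}) ` V)"
  using assms partition_on_singletons[of V]
  by (auto simp: stable_partition_def stable_set_def)

lemma stable_partition_insert:
  assumes "stable_partition (W - S) E P" "finite W" "S \<subseteq> W" "S \<noteq> {}" "stable_set E S"
  shows "stable_partition W E (insert S P)" "surplus (insert S P) = surplus P + (card S - 2)"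
proof -
  have disj: "disjnt S (\<Union>P)"
    using stable_partitionD(1)[OF assms(1)] by (auto simp: disjnt_def)
  have part: "partition_on (W - S) P"
    using assms(1) by (simp add: stable_partition_def)
  have "S \<notin> P" using disj assms(4) by (auto simp: disjnt_def)
  moreover have "finite P"
    using stable_partition_finite(1)[OF _ assms(1)] assms(2) by simp
  ultimately show "surplus (insert S P) = surplus P + (card S - 2)"
    by (simp add: surplus_def)
  have "partition_on W (insert S P)"
    using part disj assms(3,4)
    by (subst partition_on_insert) auto
  then show "stable_partition W E (insert S P)"
    using assms(1,5) by (auto simp: stable_partition_def)
qed

lemma chromatic_number_le_card:
  assumes "finite V" "stable_partition V E P"
  shows "chromatic_number V E \<le> card P"
proof -
  note D = stable_partitionD[OF assms(2)]
  obtain f where f: "bij_betw f P {0..<card P}"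
    using ex_bij_betw_finite_nat[OF stable_partition_finite(1)[OF assms]] by blast
  have "\<forall>v\<in>V. \<exists>S. S \<in> P \<and> v \<in> S" using D(1) by auto
  then obtain g where g: "\<And>v. v \<in> V \<Longrightarrow> g v \<in> P \<and> v \<in> g v" by metis
  have "f (g u) \<noteq> f (g v)" if uv: "u \<in> V" "v \<in> V" "E u v" for u v
  proof
    assume "f (g u) = f (g v)"
    then have "g u = g v"
      using f g uv by (auto simp: bij_betw_def dest: inj_onD)
    then show False using D(3)[of "g u"] g uv by (metis stable_set_def)
  qed
  moreover have "f (g v) < card P" if "v \<in> V" for v
    using f g[OF that] by (auto simp: bij_betw_def)
  ultimately have "proper_colouring V E (card P) (\<lambda>v. f (g v))"
    by (auto simp: proper_colouring_def)
  then show ?thesis unfolding chromatic_number_def by (intro Least_le) blast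
qed

text \<open>Each class satisfies \<open>2 + (\<bar>S\<bar> - 2) = \<bar>S\<bar>\<close>, except that a singleton, by truncation, yields
  one more.\<close>

lemma two_card_plus_surplus:
  assumes "finite V" "stable_partition V E P"
  shows "2 * card P + surplus P = card V + card {S \<in> P. card S = 1}"
proof -
  note F = stable_partition_finite[OF assms]
  have "card V = (\<Sum>S\<in>P. card S)"
    using assms F(2) by (auto simp: stable_partition_def intro: product_partition)
  moreover have "card {S \<in> P. card S = 1} = (\<Sum>S\<in>P. if card S = 1 then 1 else 0)"
    using F(1) by (simp add: sum.If_cases Int_def)
  moreover have "2 + (card S - 2) = card S + (if card S = 1 then 1 else 0)" if "S \<in> P" for S
  proof -
    have "card S \<noteq> 0" using that F(2) stable_partitionD(2)[OF assms(2)] by auto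
    then show ?thesis by auto
  qed
  then have "(\<Sum>S\<in>P. 2 + (card S - 2)) = (\<Sum>S\<in>P. card S + (if card S = 1 then 1 else 0))"
    by (rule sum.cong[OF refl])
  ultimately show ?thesis
    by (simp add: surplus_def sum.distrib mult.commute del: One_nat_def add_2_eq_Suc add_2_eq_Suc')
qed

section \<open>Partitions with fewest classes for a given surplus\<close>

text \<open>Bounding the surplus from below, instead of minimising the number of classes outright, allows
  the large classes of a given partition to survive the passage to an extremal one.\<close>

definition tight :: "'a set \<Rightarrow> ('a \<Rightarrow> 'a \<Rightarrow> bool) \<Rightarrow> nat \<Rightarrow> 'a set set \<Rightarrow> bool" where
  "tight V E m P \<longleftrightarrow> stable_partition V E P \<and> m \<le> surplus P \<and>
     (\<forall>Q. stable_partition V E Q \<and> m \<le> surplus Q \<longrightarrow> card P \<le> card Q)"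

lemma tight_exists:
  assumes "stable_partition V E P"
  shows "\<exists>Q. tight V E (surplus P) Q"
  using ex_has_least_nat[of "\<lambda>Q. stable_partition V E Q \<and> surplus P \<le> surplus Q" P card] assms
  unfolding tight_def by blast

text \<open>Otherwise the two classes could be merged.\<close>

lemma tight_classes_adjacent:
  assumes V: "simple_graph V E" and t: "tight V E m P"
    and S: "S \<in> P" and T: "T \<in> P" and ST: "S \<noteq> T"
  shows "\<exists>x\<in>S. \<exists>y\<in>T. E x y"
proof (rule ccontr)
  assume no: "\<not> ?thesis"
  have fin: "finite V" and sym: "\<And>x y. E x y \<Longrightarrow> E y x"
    using V by (auto simp: simple_graph_def)
  have sp: "stable_partition V E P" using t by (simp add: tight_def)
  note D = stable_partitionD[OF sp] and F = stable_partition_finite[OF fin sp]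
  define R where "R = P - {S, T}"
  have P: "P = insert S (insert T R)" "S \<notin> insert T R" "T \<notin> R" "finite R"
    using S T ST F(1) by (auto simp: R_def)
  have ne: "S \<noteq> {}" "T \<noteq> {}" and dj: "S \<inter> T = {}" and fST: "finite S" "finite T"
    using S T ST D F by auto
  have "partition_on (V - (S \<union> T)) R"
    using D S T by (intro partition_onI) (auto simp: R_def disjnt_def)
  moreover have "\<not> E y x" if "x \<in> S" "y \<in> T" for x y using no sym that by blast
  then have "stable_set E (S \<union> T)"
    using no D(3)[OF S] D(3)[OF T] by (auto simp: stable_set_def)
  moreover have "S \<union> T \<subseteq> V" using D(1) S T by auto
  ultimately have Q: "stable_partition V E (insert (S \<union> T) R)"
      "surplus (insert (S \<union> T) R) = surplus R + (card (S \<union> T) - 2)"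
    using stable_partition_insert[of V "S \<union> T" E R] fin ne D(3)
    by (auto simp: stable_partition_def R_def)
  have "card S > 0" "card T > 0" using ne fST by (auto simp: card_gt_0_iff)
  then have "surplus P \<le> surplus (insert (S \<union> T) R)"
    using P Q(2) card_Un_disjoint[OF fST dj] by (simp add: surplus_def)
  moreover have "card (insert (S \<union> T) R) < card P"
    using P card_insert_le_m1[of "Suc (card R)" R] by (simp add: card_insert_if)
  ultimately show False using t Q(1) by (force simp: tight_def)
qed

text \<open>The partition \<open>Q\<close> puts \<open>v\<close> in the place of \<open>w\<close> and makes \<open>w\<close> a singleton. The class that
  \<open>v\<close> enters stays stable because \<open>w\<close> was the only neighbour of \<open>v\<close> there. Writing \<open>Q\<close> as the image
  under a transposition makes it evident that class sizes do not change.\<close>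

lemma tight_swap:
  assumes V: "simple_graph V E" and t: "tight V E m P"
    and v: "{v} \<in> P" and I: "I \<in> P" and vI: "I \<noteq> {v}"
    and w: "{y \<in> I. E v y} = {w}"
  defines "Q \<equiv> (`) (Transposition.transpose v w) ` P"
  shows "tight V E m Q" "{w} \<in> Q" "\<And>J. J \<in> P \<Longrightarrow> J \<noteq> {v} \<Longrightarrow> J \<noteq> I \<Longrightarrow> J \<in> Q"
proof -
  let ?\<tau> = "Transposition.transpose v w"
  have fin: "finite V" and sym: "\<And>x y. E x y \<Longrightarrow> E y x" and irr: "\<And>x. \<not> E x x"
    using V by (auto simp: simple_graph_def)
  have sp: "stable_partition V E P" using t by (simp add: tight_def)
  note D = stable_partitionD[OF sp]
  have wI: "w \<in> I" "E v w" using w by auto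
  have vnI: "v \<notin> I" using D(4)[OF I v, of v] vI by auto
  have inV: "v \<in> V" "w \<in> V" using D(1) v I wI by auto
  have inj: "inj_on ((`) ?\<tau>) P" by (intro inj_onI) (metis inj_image_eq_iff inj_transpose)
  have fixed: "?\<tau> ` J = J" if "J \<in> P" "J \<noteq> {v}" "J \<noteq> I" for J
  proof -
    have "v \<notin> J" "w \<notin> J" using D(4)[of J "{v}" v] D(4)[of J I w] that v I wI by auto
    then show ?thesis by (intro transpose_image_eq) simp
  qed
  have imI: "?\<tau> ` I = insert v (I - {w})"
    using wI(1) vnI by (auto simp: in_transpose_image_iff transpose_eq_iff image_iff transpose_def)
  have "partition_on (?\<tau> ` V) Q"
    using partition_on_inj_image[of V P ?\<tau>] sp D(2) unfolding Q_def stable_partition_def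
    by (metis (no_types, lifting) Diff_empty Diff_insert0 image_iff image_is_empty inj_on_transpose)
  then have part: "partition_on V Q" using inV by (simp add: transpose_image_eq)
  have "stable_set E (?\<tau> ` J)" if "J \<in> P" for J
  proof -
    consider "J = {v}" | "J = I" | "J \<noteq> {v}" "J \<noteq> I" by blast
    then show ?thesis
    proof cases
      case 2
      have "\<not> E v y" "\<not> E y v" if "y \<in> I - {w}" for y using w that sym by auto
      then show ?thesis
        unfolding 2 imI using D(3)[OF I] irr by (auto simp: stable_set_def)
    qed (use irr fixed D(3) that in \<open>auto simp: stable_set_def\<close>)
  qed
  then have spQ: "stable_partition V E Q" using part by (auto simp: stable_partition_def Q_def)
  have "card Q = card P" unfolding Q_def by (rule card_image[OF inj])
  moreover have "card (?\<tau> ` J) = card J" for J by (rule card_image) simp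
  then have "surplus Q = surplus P"
    unfolding Q_def surplus_def by (simp add: sum.reindex[OF inj])
  ultimately show "tight V E m Q" using t spQ by (auto simp: tight_def)
  show "{w} \<in> Q" using imageI[OF v, of "(`) ?\<tau>"] by (simp add: Q_def)
  show "J \<in> Q" if "J \<in> P" "J \<noteq> {v}" "J \<noteq> I" for J
    using imageI[OF that(1), of "(`) ?\<tau>"] fixed[OF that] by (simp add: Q_def)
qed

text \<open>After the exchange, \<open>{w}\<close> and \<open>{x}\<close> are two classes of an extremal partition.\<close>

lemma unique_neighbour_adjacent:
  assumes V: "simple_graph V E" and t: "tight V E m P"
    and v: "{v} \<in> P" and x: "{x} \<in> P" "x \<noteq> v"
    and I: "I \<in> P" "I \<noteq> {v}" "I \<noteq> {x}" and w: "{y \<in> I. E v y} = {w}"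
  shows "E w x"
proof -
  note s = tight_swap[OF V t v I(1,2) w]
  have sp: "stable_partition V E P" using t by (simp add: tight_def)
  have "w \<noteq> x" using stable_partitionD(4)[OF sp I(1) x(1), of x] w I(3) by auto
  moreover have "{x} \<noteq> {v}" using x(2) by simp
  ultimately show ?thesis
    using tight_classes_adjacent[OF V s(1) s(2) s(3)[OF x(1) _ I(3)[symmetric]]] by auto
qed

text \<open>After the exchange of \<open>v\<close> and \<open>w\<close>, the singletons are \<open>x\<close> and \<open>w\<close>, while \<open>J\<close> is still a class;
  the previous lemma then applies with \<open>x\<close> as the vertex to be exchanged.\<close>

lemma unique_neighbours_adjacent:
  assumes V: "simple_graph V E" and t: "tight V E m P"
    and v: "{v} \<in> P" and x: "{x} \<in> P" "x \<noteq> v"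
    and I: "I \<in> P" "I \<noteq> {v}" "I \<noteq> {x}" and J: "J \<in> P" "J \<noteq> {v}" "J \<noteq> {x}" and IJ: "I \<noteq> J"
    and w: "{y \<in> I. E v y} = {w}" and z: "{y \<in> J. E x y} = {z}"
  shows "E w z"
proof -
  let ?Q = "(`) (Transposition.transpose v w) ` P"
  note s = tight_swap[OF V t v I(1,2) w]
  have sp: "stable_partition V E P" using t by (simp add: tight_def)
  have wI: "w \<in> I" using w by auto
  have "w \<noteq> x" using stable_partitionD(4)[OF sp I(1) x(1), of x] wI I(3) by auto
  moreover have "J \<noteq> {w}" using stable_partitionD(4)[OF sp I(1) J(1), of w] wI IJ by auto
  moreover have "{x} \<in> ?Q" using s(3)[OF x(1)] x(2) I(3) by auto
  moreover have "J \<in> ?Q" using s(3)[OF J(1,2)] IJ by auto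
  ultimately have "E z w"
    using unique_neighbour_adjacent[OF V s(1), of x w J z] s(2) J(3) z by auto
  then show ?thesis using V by (auto simp: simple_graph_def)
qed

lemma degree_le_max_degree:
  assumes "finite V" "v \<in> V"
  shows "degree V E v \<le> max_degree V E"
  using assms by (auto simp: max_degree_def intro: Max_ge)

lemma card_le_clique_number:
  assumes "simple_graph V E" "clique V E K"
  shows "card K \<le> clique_number V E"
  unfolding clique_number_def
  using assms clique_sizes_finite_nonempty(1)[OF assms(1)] by (intro Max_ge) auto

text \<open>A singleton vertex has two neighbours in every other class, except for one neighbour
  in the classes counted by the second summand.\<close>

lemma singleton_degree:
  assumes V: "simple_graph V E" and t: "tight V E m P" and v: "{v} \<in> P"
  shows "2 * card P \<le> degree V E v + card {X \<in> P. card {y \<in> X. E v y} = 1} + 2"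
proof -
  let ?d = "\<lambda>X. card {y \<in> X. E v y}"
  have fin: "finite V" and irr: "\<not> E v v" using V by (auto simp: simple_graph_def)
  have sp: "stable_partition V E P" using t by (simp add: tight_def)
  note D = stable_partitionD[OF sp] and F = stable_partition_finite[OF fin sp]
  have "{y \<in> V. E v y} = (\<Union>X\<in>P. {y \<in> X. E v y})" using D(1) by auto
  then have "degree V E v = card (\<Union>X\<in>P. {y \<in> X. E v y})" by (simp add: degree_def)
  also have "\<dots> = (\<Sum>X\<in>P. ?d X)"
    using F D(4) by (intro card_UN_disjoint) auto
  finally have deg: "degree V E v = (\<Sum>X\<in>P. ?d X)" .
  have "2 \<le> ?d X + (if ?d X = 1 then 1 else 0)" if X: "X \<in> P - {{v}}" for X
  proof -
    obtain y where "y \<in> X" "E v y"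
      using tight_classes_adjacent[OF V t v, of X] X by blast
    then have "?d X \<noteq> 0" using F(2)[of X] X by auto
    then show ?thesis by auto
  qed
  then have "(\<Sum>X\<in>P - {{v}}. 2) \<le> (\<Sum>X\<in>P - {{v}}. ?d X + (if ?d X = 1 then 1 else 0))"
    by (rule sum_mono)
  also have "\<dots> \<le> (\<Sum>X\<in>P. ?d X + (if ?d X = 1 then 1 else 0))"
    using F(1) by (intro sum_mono2) auto
  also have "\<dots> = degree V E v + card {X \<in> P. ?d X = 1}"
    using F(1) by (simp add: deg sum.distrib sum.If_cases Int_def)
  finally show ?thesis using v F(1) by (simp add: card_Diff_singleton)
qed

text \<open>Let \<open>A u\<close> and \<open>A v\<close> be the sets of classes containing a unique neighbour of \<open>u\<close> and of \<open>v\<close>,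
  and let \<open>C\<close> be their intersection. The common unique neighbours give \<open>\<bar>C\<bar> + 2 \<le> \<omega>\<close>. Averaging the
  degrees of \<open>u\<close> and \<open>v\<close> gives \<open>4 * \<bar>P\<bar> \<le> 2 * \<Delta> + \<bar>A u\<bar> + \<bar>A v\<bar> + 4\<close>, where
  \<open>\<bar>A u\<bar> + \<bar>A v\<bar> \<le> \<bar>P\<bar> + \<bar>C\<bar>\<close>. So few common classes mean a large degree and many mean a large
  clique; the coefficients \<open>1\<close> and \<open>3\<close> balance the two cases, using \<open>\<bar>C\<bar> \<le> \<bar>P\<bar>\<close>.\<close>

lemma two_singletons_bound:
  assumes V: "simple_graph V E" and t: "tight V E m P"
    and u: "{u} \<in> P" and v: "{v} \<in> P" and uv: "u \<noteq> v"
  shows "4 * card P \<le> clique_number V E + 3 * max_degree V E + 4"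
proof -
  let ?A = "\<lambda>x. {X \<in> P. card {y \<in> X. E x y} = 1}"
  have fin: "finite V" and sym: "\<And>x y. E x y \<Longrightarrow> E y x" and irr: "\<And>x. \<not> E x x"
    using V by (auto simp: simple_graph_def)
  have sp: "stable_partition V E P" using t by (simp add: tight_def)
  note D = stable_partitionD[OF sp] and F = stable_partition_finite[OF fin sp]
  define C where "C = ?A u \<inter> ?A v"
  \<comment> \<open>the classes of \<open>u\<close> and \<open>v\<close> drop out of \<open>C\<close>, as each contains no neighbour of its own vertex\<close>
  have own: "{y \<in> {x}. E x y} = {}" for x using irr by auto
  have CD: "X \<in> P \<and> card {y \<in> X. E u y} = 1 \<and> card {y \<in> X. E v y} = 1" if "X \<in> C" for X
    using that unfolding C_def by blast
  have CP: "C \<subseteq> P" using CD by blast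
  have "card {y \<in> {x}. E x y} \<noteq> 1" for x unfolding own by simp
  then have CP': "{u} \<notin> C" "{v} \<notin> C" using CD by blast+
  have Cne: "X \<in> P" "X \<noteq> {u}" "X \<noteq> {v}" if "X \<in> C" for X using CP CP' that by auto
  have "\<exists>w. {y \<in> X. E u y} = {w} \<and> {y \<in> X. E v y} = {w}" if X: "X \<in> C" for X
  proof -
    obtain w z where wz: "{y \<in> X. E u y} = {w}" "{y \<in> X. E v y} = {z}"
      using CD[OF X] by (auto simp: card_1_singleton_iff)
    have "E w v"
      using unique_neighbour_adjacent[OF V t u v _ _ _ _ wz(1)] uv Cne[OF X] by auto
    then have "w \<in> {y \<in> X. E v y}" using wz(1) sym[of w v] by blast
    then show ?thesis using wz by auto
  qed
  then obtain w where w: "\<And>X. X \<in> C \<Longrightarrow> {y \<in> X. E u y} = {w X} \<and> {y \<in> X. E v y} = {w X}"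
    by metis
  have wX: "w X \<in> X" "E u (w X)" "E v (w X)" if "X \<in> C" for X using w[OF that] by auto
  have inj: "inj_on w C"
    using wX(1) D(4) Cne(1) by (intro inj_onI) metis
  have "E u v" using tight_classes_adjacent[OF V t u v] uv by auto
  have "E (w X) (w Y)" if "X \<in> C" "Y \<in> C" "X \<noteq> Y" for X Y
    by (rule unique_neighbours_adjacent[OF V t u v uv[symmetric] Cne[OF that(1)] Cne[OF that(2)] that(3)])
      (use w that in blast)+
  moreover have "E v u" "E (w X) u" "E (w X) v" if "X \<in> C" for X
    using \<open>E u v\<close> wX[OF that] sym by blast+
  moreover have "u \<in> V" "v \<in> V" "w ` C \<subseteq> V" using D(1) u v CP wX(1) by blast+
  ultimately have "clique V E (insert u (insert v (w ` C)))"
    using \<open>E u v\<close> sym[OF \<open>E u v\<close>] wX unfolding clique_def by auto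
  then have "card (insert u (insert v (w ` C))) \<le> clique_number V E"
    by (rule card_le_clique_number[OF V])
  moreover have "u \<notin> w ` C" "v \<notin> w ` C" using wX irr by auto
  moreover have "finite C" using CP F(1) by (rule finite_subset)
  ultimately have om: "card C + 2 \<le> clique_number V E"
    using uv card_image[OF inj] by simp
  have "card (?A u) + card (?A v) = card (?A u \<union> ?A v) + card C"
    unfolding C_def using F(1) by (intro card_Un_Int) auto
  also have "\<dots> \<le> card P + card C" using F(1) by (intro add_right_mono card_mono) auto
  finally have "card (?A u) + card (?A v) \<le> card P + card C" .
  moreover have "u \<in> V" "v \<in> V" using D(1) u v by auto
  ultimately have "4 * card P \<le> 2 * max_degree V E + card P + card C + 4"
    using singleton_degree[OF V t u] singleton_degree[OF V t v]
      degree_le_max_degree[OF fin, of u E] degree_le_max_degree[OF fin, of v E] by linarith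
  moreover have "card C \<le> card P" using CP F(1) by (intro card_mono)
  ultimately show ?thesis using om by linarith
qed

text \<open>The first alternative arises when an extremal partition for the surplus of \<open>P\<close> has two
  singleton classes, the second when it has at most one.\<close>

lemma chromatic_bound_or_surplus_bound:
  assumes V: "simple_graph V E" and P: "stable_partition V E P"
  shows "4 * chromatic_number V E \<le> clique_number V E + 3 * max_degree V E + 4 \<or>
    2 * chromatic_number V E + surplus P \<le> card V + 1"
proof -
  have fin: "finite V" using V by (simp add: simple_graph_def)
  obtain Q where t: "tight V E (surplus P) Q" using tight_exists[OF P] by blast
  have spQ: "stable_partition V E Q" and le: "surplus P \<le> surplus Q"
    using t by (auto simp: tight_def)
  have chi: "chromatic_number V E \<le> card Q" by (rule chromatic_number_le_card[OF fin spQ])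
  show ?thesis
  proof (cases "card {S \<in> Q. card S = 1} \<le> 1")
    case True
    then show ?thesis using two_card_plus_surplus[OF fin spQ] le chi by linarith
  next
    case False
    then have "\<not> (\<forall>S\<in>{S \<in> Q. card S = 1}. \<forall>T\<in>{S \<in> Q. card S = 1}. S = T)"
      using stable_partition_finite(1)[OF fin spQ] by (simp add: card_le_Suc0_iff_eq)
    then obtain S T where ST: "S \<in> Q" "card S = 1" "T \<in> Q" "card T = 1" "S \<noteq> T" by auto
    then obtain u v where "S = {u}" "T = {v}" by (metis card_1_singletonE)
    then show ?thesis using two_singletons_bound[OF V t, of u v] ST chi by auto
  qed
qed

section \<open>Ramsey arguments for a large surplus\<close>

lemma stable_insert:
  assumes "\<And>x y. E x y \<Longrightarrow> E y x" "\<not> E v v" "stable_set E S" "\<And>x. x \<in> S \<Longrightarrow> \<not> E v x"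
  shows "stable_set E (insert v S)"
  using assms by (auto simp: stable_set_def)

text \<open>A graph and its complement enter the Ramsey arguments symmetrically, and both cliques and
  stable sets become stable sets of one of the two graphs. Since no pair is adjacent in both, every
  pair of vertices is stable in one of them.\<close>

locale edge_disjoint_graphs =
  fixes E E' :: "'a \<Rightarrow> 'a \<Rightarrow> bool"
  assumes sym: "E x y \<Longrightarrow> E y x" "E' x y \<Longrightarrow> E' y x"
    and irrefl: "\<not> E x x" "\<not> E' x x"
    and edge_disjoint: "\<not> (E x y \<and> E' x y)"
begin

lemma exchange: "edge_disjoint_graphs E' E"
  using sym irrefl edge_disjoint by unfold_locales blast+

lemma stable_extend:
  assumes "finite S" "v \<notin> S" "stable_set E S" "\<And>x. x \<in> S \<Longrightarrow> \<not> E v x"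
  shows "stable_set E (insert v S) \<and> card (insert v S) = Suc (card S)"
  using assms stable_insert[of E v S] sym irrefl by simp

lemma pair_stable: "stable_set E {x, y} \<or> stable_set E' {x, y}"
  using sym irrefl edge_disjoint by (auto simp: stable_set_def)

lemma two_sided_neighbourhoods:
  assumes "finite W" "v \<in> W"
  shows "card W \<le> card {x \<in> W - {v}. \<not> E v x} + card {x \<in> W - {v}. \<not> E' v x} + 1"
proof -
  have "W = insert v ({x \<in> W - {v}. \<not> E v x} \<union> {x \<in> W - {v}. \<not> E' v x})"
    using assms(2) edge_disjoint by auto
  then have "card W = card (insert v ({x \<in> W - {v}. \<not> E v x} \<union> {x \<in> W - {v}. \<not> E' v x}))"
    by simp
  also have "\<dots> \<le> Suc (card ({x \<in> W - {v}. \<not> E v x} \<union> {x \<in> W - {v}. \<not> E' v x}))"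
    using assms(1) by (simp add: card_insert_if)
  also have "\<dots> \<le> Suc (card {x \<in> W - {v}. \<not> E v x} + card {x \<in> W - {v}. \<not> E' v x})"
    by (simp add: card_Un_le)
  finally show ?thesis by simp
qed

text \<open>Two non-neighbours of \<open>v\<close> that are adjacent in \<open>E'\<close> are stable in \<open>E\<close>, and remain so together with
  \<open>v\<close>.\<close>

lemma ramsey_at_vertex:
  assumes "finite W" "v \<in> W" "k \<le> card {x \<in> W - {v}. \<not> E v x}"
  shows "(\<exists>S\<subseteq>W. card S = 3 \<and> stable_set E S) \<or> (\<exists>S\<subseteq>W. card S = k \<and> stable_set E' S)"
proof -
  obtain N where N: "N \<subseteq> {x \<in> W - {v}. \<not> E v x}" "card N = k"
    using assms(3) by (meson obtain_subset_with_card_n)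
  show ?thesis
  proof (cases "stable_set E' N")
    case True
    then show ?thesis using N by (intro disjI2 exI[of _ N]) auto
  next
    case False
    then obtain x y where xy: "x \<in> N" "y \<in> N" "E' x y" by (auto simp: stable_set_def)
    have ne: "x \<noteq> y" "v \<noteq> x" "v \<noteq> y" using xy irrefl N(1) by auto
    have "stable_set E {x, y}" using pair_stable[of x y] xy by (auto simp: stable_set_def)
    then have "stable_set E {v, x, y} \<and> card {v, x, y} = 3"
      using stable_extend[of "{x, y}" v] N(1) xy ne by auto
    then show ?thesis using N(1) xy assms(2) by (intro disjI1 exI[of _ "{v, x, y}"]) auto
  qed
qed

end

lemma (in edge_disjoint_graphs) ramsey_3_3:
  assumes "finite W" "6 \<le> card W"
  shows "\<exists>S\<subseteq>W. card S = 3 \<and> (stable_set E S \<or> stable_set E' S)"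
proof -
  interpret ex: edge_disjoint_graphs E' E by (rule exchange)
  obtain v where v: "v \<in> W" using assms by fastforce
  have "3 \<le> card {x \<in> W - {v}. \<not> E v x} \<or> 3 \<le> card {x \<in> W - {v}. \<not> E' v x}"
    using two_sided_neighbourhoods[OF assms(1) v] assms(2) by linarith
  then show ?thesis
    using ramsey_at_vertex[OF assms(1) v] ex.ramsey_at_vertex[OF assms(1) v] by blast
qed

lemma (in edge_disjoint_graphs) ramsey_3_4:
  assumes "finite W" "10 \<le> card W"
  shows "(\<exists>S\<subseteq>W. card S = 3 \<and> stable_set E S) \<or> (\<exists>S\<subseteq>W. card S = 4 \<and> stable_set E' S)"
proof -
  interpret ex: edge_disjoint_graphs E' E by (rule exchange)
  obtain v where v: "v \<in> W" using assms by fastforce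
  have "4 \<le> card {x \<in> W - {v}. \<not> E v x} \<or> 6 \<le> card {x \<in> W - {v}. \<not> E' v x}"
    using two_sided_neighbourhoods[OF assms(1) v] assms(2) by linarith
  then show ?thesis
  proof
    assume "4 \<le> card {x \<in> W - {v}. \<not> E v x}"
    then show ?thesis by (rule ramsey_at_vertex[OF assms(1) v])
  next
    assume b: "6 \<le> card {x \<in> W - {v}. \<not> E' v x}"
    obtain S where S: "S \<subseteq> {x \<in> W - {v}. \<not> E' v x}" "card S = 3" "stable_set E S \<or> stable_set E' S"
      using ramsey_3_3[OF _ b] assms(1) by auto
    show ?thesis
    proof (cases "stable_set E S")
      case True
      then show ?thesis using S by (intro disjI1 exI[of _ S]) auto
    next
      case False
      have "finite S" using S(2) by (simp add: card_ge_0_finite)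
      then have "stable_set E' (insert v S) \<and> card (insert v S) = 4"
        using ex.stable_extend[of S v] S(1) S(2,3) False by fastforce
      then show ?thesis using S(1) v by (intro disjI2 exI[of _ "insert v S"]) auto
    qed
  qed
qed

text \<open>By \<open>R(3,4) \<le> 10\<close>, stable triples of \<open>E\<close> can be split off until at most nine vertices are left,
  each triple adding one to the surplus.\<close>

lemma (in edge_disjoint_graphs) triple_packing:
  assumes "finite W" "\<not> (\<exists>S\<subseteq>W. card S = 4 \<and> stable_set E' S)"
  shows "\<exists>P. stable_partition W E P \<and> card W \<le> 3 * surplus P + 9"
  using assms
proof (induction "card W" arbitrary: W rule: less_induct)
  case less
  show ?case
  proof (cases "card W \<le> 9")
    case True
    then show ?thesis using stable_partition_singletons[of E W] irrefl by auto
  next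
    case False
    then obtain S where S: "S \<subseteq> W" "card S = 3" "stable_set E S"
      using ramsey_3_4[of W] less.prems by auto
    have cd: "card (W - S) = card W - 3"
      using S less.prems(1) by (simp add: card_Diff_subset finite_subset)
    have "card (W - S) < card W" using cd False by simp
    moreover have "\<not> (\<exists>S'\<subseteq>W - S. card S' = 4 \<and> stable_set E' S')" using less.prems(2) by blast
    ultimately obtain P where P: "stable_partition (W - S) E P" "card (W - S) \<le> 3 * surplus P + 9"
      using less.hyps[of "W - S"] less.prems(1) by auto
    have "S \<noteq> {}" using S(2) by auto
    note ins = stable_partition_insert[OF P(1) less.prems(1) S(1) this S(3)]
    have "card W \<le> 3 * surplus (insert S P) + 9" using ins(2) P(2) cd S(2) by simp
    then show ?thesis using ins(1) by blast
  qed
qed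

lemma (in edge_disjoint_graphs) triple_partition:
  assumes "finite W" "S \<subseteq> W" "card S = 3" "stable_set E S"
  shows "\<exists>P. stable_partition W E P \<and> surplus P \<ge> 1"
proof -
  have "S \<noteq> {}" using assms(3) by auto
  note ins = stable_partition_insert[OF stable_partition_singletons assms(1,2) this assms(4), OF irrefl(1)]
  show ?thesis using ins assms(3) by (intro exI conjI) auto
qed

text \<open>For a graph \<open>E\<close> and its complement \<open>E'\<close>, \<open>K\<close> is a clique of \<open>E\<close> and \<open>L\<close> a clique of \<open>E'\<close>.
  The weights are those with which surplus and clique numbers enter when the failure of the colouring
  bound for both graphs is added up.\<close>

definition (in edge_disjoint_graphs) well_packed :: "'a set \<Rightarrow> bool" where
  "well_packed W \<longleftrightarrow> (\<exists>K L P Q. K \<subseteq> W \<and> L \<subseteq> W \<and> stable_set E' K \<and> stable_set E L \<and>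
     stable_partition W E P \<and> stable_partition W E' Q \<and>
     card W \<le> 2 * (surplus P + surplus Q) + card K + card L + 2)"

text \<open>A new class of size four raises the surplus by two, which pays exactly for its four vertices;
  size three would pay for only two of three.\<close>

lemma (in edge_disjoint_graphs) well_packed_add_4:
  assumes "finite W" "S \<subseteq> W" "card S = 4" "stable_set E S" "well_packed (W - S)"
  shows "well_packed W"
proof -
  obtain K L P Q where h: "K \<subseteq> W - S" "L \<subseteq> W - S" "stable_set E' K" "stable_set E L"
     "stable_partition (W - S) E P" "stable_partition (W - S) E' Q"
     "card (W - S) \<le> 2 * (surplus P + surplus Q) + card K + card L + 2"
    using assms(5) unfolding well_packed_def by blast
  have "S \<noteq> {}" using assms(3) by auto
  note insP = stable_partition_insert[OF h(5) assms(1,2) this assms(4)]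
  \<comment> \<open>the vertices of \<open>S\<close> become singletons in the other partition\<close>
  let ?Q = "(\<lambda>x. {x}) ` S \<union> Q"
  have dj: "(\<lambda>x. {x}) ` S \<inter> Q = {}" using stable_partitionD(1)[OF h(6)] by auto
  have "partition_on (W - S) Q" using h(6) by (simp add: stable_partition_def)
  then have "partition_on W ?Q"
    using assms(2) by (intro partition_onI) (auto simp: partition_on_def disjnt_def dest: stable_partitionD(4)[OF h(6)])
  moreover have "\<forall>X\<in>?Q. stable_set E' X" using h(6) irrefl by (auto simp: stable_partition_def stable_set_def)
  ultimately have spQ: "stable_partition W E' ?Q" by (simp add: stable_partition_def)
  have fS: "finite S" "finite Q"
    using assms(1,2) stable_partition_finite(1)[OF _ h(6)] by (auto intro: finite_subset)
  then have "surplus ?Q = surplus ((\<lambda>x. {x}) ` S) + surplus Q"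
    using dj by (simp add: surplus_def sum.union_disjoint)
  then have "surplus Q \<le> surplus ?Q" by simp
  moreover have "card (W - S) = card W - 4"
    using assms fS(1) by (simp add: card_Diff_subset)
  ultimately have "card W \<le> 2 * (surplus (insert S P) + surplus ?Q) + card K + card L + 2"
    using insP(2) assms(3) h(7) by simp
  then show ?thesis unfolding well_packed_def using h insP(1) spQ by blast
qed

lemma (in edge_disjoint_graphs) well_packed_exchange:
  assumes "edge_disjoint_graphs.well_packed E' E W"
  shows "well_packed W"
proof -
  obtain K L P Q where h: "K \<subseteq> W" "L \<subseteq> W" "stable_set E K" "stable_set E' L"
     "stable_partition W E' P" "stable_partition W E Q"
     "card W \<le> 2 * (surplus P + surplus Q) + card K + card L + 2"
    using assms unfolding edge_disjoint_graphs.well_packed_def[OF exchange] by blast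
  have "card W \<le> 2 * (surplus Q + surplus P) + card L + card K + 2" using h(7) by simp
  then show ?thesis unfolding well_packed_def using h(1-6) by blast
qed

text \<open>Up to six vertices the sets \<open>K\<close> and \<open>L\<close> suffice; from seven to nine a single triple serves both
  as a class and as \<open>K\<close> or \<open>L\<close>. From ten vertices on, both graphs contain stable triples and admit
  triple packings. These may overlap: the same vertex counts for both surpluses, and this
  compensates for the poor yield of the single triples.\<close>

lemma (in edge_disjoint_graphs) well_packed_base:
  assumes fin: "finite W"
    and noE: "\<not> (\<exists>S\<subseteq>W. card S = 4 \<and> stable_set E S)"
    and noE': "\<not> (\<exists>S\<subseteq>W. card S = 4 \<and> stable_set E' S)"
  shows "well_packed W"
proof -
  interpret ex: edge_disjoint_graphs E' E by (rule exchange)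
  let ?P0 = "(\<lambda>x. {x}) ` W"
  have P0: "stable_partition W E ?P0" "stable_partition W E' ?P0"
    using stable_partition_singletons irrefl by blast+
  have big: "\<exists>S\<subseteq>W. card S = 2 \<and> stable_set E S" "\<exists>S\<subseteq>W. card S = 2 \<and> stable_set E' S" if W: "4 \<le> card W"
  proof -
    obtain S where S: "S \<subseteq> W" "card S = 4" using W by (meson obtain_subset_with_card_n)
    obtain x y where xy: "x \<in> S" "y \<in> S" "E' x y" using noE' S by (auto simp: stable_set_def)
    then have "stable_set E {x, y}" "x \<noteq> y" using pair_stable[of x y] irrefl by (auto simp: stable_set_def)
    then show "\<exists>S\<subseteq>W. card S = 2 \<and> stable_set E S" using xy S by (intro exI[of _ "{x, y}"]) auto
    obtain x y where xy: "x \<in> S" "y \<in> S" "E x y" using noE S by (auto simp: stable_set_def)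
    then have "stable_set E' {x, y}" "x \<noteq> y" using pair_stable[of x y] irrefl by (auto simp: stable_set_def)
    then show "\<exists>S\<subseteq>W. card S = 2 \<and> stable_set E' S" using xy S by (intro exI[of _ "{x, y}"]) auto
  qed
  consider (a) "card W \<le> 2" | (b) "3 \<le> card W" "card W \<le> 4" | (c) "5 \<le> card W" "card W \<le> 6"
    | (d) "7 \<le> card W" "card W \<le> 9" | (e) "10 \<le> card W" by linarith
  then show ?thesis
  proof cases
    case a
    have "stable_set E {}" "stable_set E' {}" by (auto simp: stable_set_def)
    with a show ?thesis unfolding well_packed_def using P0 by (meson empty_subsetI trans_le_add2)
  next
    case b
    then obtain v where "v \<in> W" by fastforce
    moreover have "stable_set E {v}" "stable_set E' {v}" using irrefl by (auto simp: stable_set_def)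
    moreover have "card W \<le> 2 * (surplus ?P0 + surplus ?P0) + card {v} + card {v} + 2"
      using b by simp
    ultimately show ?thesis unfolding well_packed_def using P0
      by (intro exI[of _ "{v}"] exI[of _ ?P0]) auto
  next
    case c
    then obtain K L where KL: "K \<subseteq> W" "card K = 2" "stable_set E' K" "L \<subseteq> W" "card L = 2" "stable_set E L"
      using big by auto
    moreover have "card W \<le> 2 * (surplus ?P0 + surplus ?P0) + card K + card L + 2"
      using c KL by simp
    ultimately show ?thesis unfolding well_packed_def using P0 by blast
  next
    case d
    obtain S where S: "S \<subseteq> W" "card S = 3" "stable_set E S \<or> stable_set E' S"
      using ramsey_3_3[OF fin] d by auto
    obtain K L where KL: "K \<subseteq> W" "card K = 2" "stable_set E' K" "L \<subseteq> W" "card L = 2" "stable_set E L"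
      using big d by auto
    show ?thesis
    proof (cases "stable_set E S")
      case True
      then obtain P where P: "stable_partition W E P" "surplus P \<ge> 1"
        using triple_partition[OF fin S(1,2)] by blast
      then have "card W \<le> 2 * (surplus P + surplus ?P0) + card K + card S + 2"
        using d KL S by simp
      then show ?thesis unfolding well_packed_def using P KL S True P0 by blast
    next
      case False
      then obtain P where P: "stable_partition W E' P" "surplus P \<ge> 1"
        using ex.triple_partition[OF fin S(1,2)] S(3) by blast
      then have "card W \<le> 2 * (surplus ?P0 + surplus P) + card S + card L + 2"
        using d KL S by simp
      then show ?thesis unfolding well_packed_def using P KL S False P0 by blast
    qed
  next
    case e
    obtain L where L: "L \<subseteq> W" "card L = 3" "stable_set E L" using ramsey_3_4[OF fin e] noE' by blast
    obtain K where K: "K \<subseteq> W" "card K = 3" "stable_set E' K" using ex.ramsey_3_4[OF fin e] noE by blast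
    obtain P where P: "stable_partition W E P" "card W \<le> 3 * surplus P + 9"
      using triple_packing[OF fin noE'] by blast
    obtain Q where Q: "stable_partition W E' Q" "card W \<le> 3 * surplus Q + 9"
      using ex.triple_packing[OF fin noE] by blast
    have "1 \<le> surplus P" "1 \<le> surplus Q" using e P(2) Q(2) by linarith+
    then have "card W \<le> 2 * (surplus P + surplus Q) + card K + card L + 2"
      using P(2) Q(2) K(2) L(2) unfolding distrib_left by linarith
    then show ?thesis unfolding well_packed_def using P Q K L by blast
  qed
qed

lemma (in edge_disjoint_graphs) well_packed:
  assumes "finite W"
  shows "well_packed W"
  using assms
proof (induction "card W" arbitrary: W rule: less_induct)
  case less
  interpret ex: edge_disjoint_graphs E' E by (rule exchange)
  have step: "well_packed (W - S)" if "S \<subseteq> W" "card S = 4" for S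
    using less.hyps[of "W - S"] less.prems that
    by (metis card_Diff_subset card_mono diff_less finite_Diff finite_subset less_le_trans
        zero_less_numeral)
  consider (E) S where "S \<subseteq> W" "card S = 4" "stable_set E S"
    | (E') S where "S \<subseteq> W" "card S = 4" "stable_set E' S"
    | (none) "\<not> (\<exists>S\<subseteq>W. card S = 4 \<and> stable_set E S)" "\<not> (\<exists>S\<subseteq>W. card S = 4 \<and> stable_set E' S)"
    by blast
  then show ?case
  proof cases
    case E
    then show ?thesis using well_packed_add_4[OF less.prems] step by blast
  next
    case E'
    then have "ex.well_packed (W - S)" using ex.well_packed_exchange step by blast
    then show ?thesis using ex.well_packed_add_4[OF less.prems E'] well_packed_exchange by blast
  next
    case none
    then show ?thesis by (rule well_packed_base[OF less.prems])
  qed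
qed

section \<open>The bound for a graph or its complement\<close>

lemma degree_complement:
  assumes "simple_graph V E" "v \<in> V"
  shows "degree V E v + degree V (complement V E) v + 1 = card V"
proof -
  have fin: "finite V" and irr: "\<not> E v v" using assms by (auto simp: simple_graph_def)
  have "V = insert v ({u \<in> V. E v u} \<union> {u \<in> V. complement V E v u})"
    using assms irr by (auto simp: complement_def)
  then have "card V = card (insert v ({u \<in> V. E v u} \<union> {u \<in> V. complement V E v u}))" by simp
  also have "\<dots> = Suc (card ({u \<in> V. E v u} \<union> {u \<in> V. complement V E v u}))"
    using fin irr by (subst card_insert_disjoint) (auto simp: complement_def)
  also have "card ({u \<in> V. E v u} \<union> {u \<in> V. complement V E v u}) =
      card {u \<in> V. E v u} + card {u \<in> V. complement V E v u}"
    using fin by (intro card_Un_disjoint) (auto simp: complement_def)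
  finally show ?thesis by (simp add: degree_def)
qed

theorem mainTheorem1:
  fixes V :: "'a set" and E :: "'a \<Rightarrow> 'a \<Rightarrow> bool"
  assumes "simple_graph V E"
  shows "\<exists>H \<in> {E, complement V E}.
    real (chromatic_number V H) \<le>
      1 / 4 * real (clique_number V H) + 3 / 4 * real (max_degree V H) + 1"
proof -
  let ?E' = "complement V E"
  have fin: "finite V" using assms by (simp add: simple_graph_def)
  have V': "simple_graph V ?E'" by (rule simple_graph_complement[OF assms])
  interpret edge_disjoint_graphs E ?E'
  proof
    show "E x y \<Longrightarrow> E y x" "\<not> E x x" for x y using assms by (simp_all add: simple_graph_def)
    show "?E' x y \<Longrightarrow> ?E' y x" "\<not> ?E' x x" for x y using V' by (simp_all add: simple_graph_def)
    show "\<not> (E x y \<and> ?E' x y)" for x y by (simp add: complement_def)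
  qed
  obtain K L P Q where h: "K \<subseteq> V" "L \<subseteq> V" "stable_set ?E' K" "stable_set E L"
     "stable_partition V E P" "stable_partition V ?E' Q"
     "card V \<le> 2 * (surplus P + surplus Q) + card K + card L + 2"
    using well_packed[OF fin] unfolding well_packed_def by blast
  have "clique V E K"
    using h(1,3) unfolding clique_def stable_set_def complement_def by blast
  moreover have "clique V ?E' L"
    using h(2,4) unfolding clique_def stable_set_def complement_def by blast
  ultimately have KL: "card K \<le> clique_number V E" "card L \<le> clique_number V ?E'"
    using card_le_clique_number[OF assms] card_le_clique_number[OF V'] by simp_all
  have \<Delta>: "card V \<le> max_degree V E + max_degree V ?E' + 1"
  proof (cases "V = {}")
    case False
    then obtain v where "v \<in> V" by blast
    then show ?thesis
      using degree_complement[OF assms] degree_le_max_degree[OF fin, of v E]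
        degree_le_max_degree[OF fin, of v ?E'] by force
  qed simp
  have "4 * chromatic_number V E \<le> clique_number V E + 3 * max_degree V E + 4 \<or>
      4 * chromatic_number V ?E' \<le> clique_number V ?E' + 3 * max_degree V ?E' + 4"
  proof (rule ccontr)
    assume no: "\<not> ?thesis"
    have "2 * chromatic_number V E + surplus P \<le> card V + 1"
      using chromatic_bound_or_surplus_bound[OF assms h(5)] no by blast
    moreover have "2 * chromatic_number V ?E' + surplus Q \<le> card V + 1"
      using chromatic_bound_or_surplus_bound[OF V' h(6)] no by blast
    moreover have "\<not> 4 * chromatic_number V E \<le> clique_number V E + 3 * max_degree V E + 4"
      "\<not> 4 * chromatic_number V ?E' \<le> clique_number V ?E' + 3 * max_degree V ?E' + 4"
      using no by blast+
    ultimately show False using h(7) KL \<Delta> unfolding distrib_left by linarith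
  qed
  moreover have "real (chromatic_number V H) \<le>
      1 / 4 * real (clique_number V H) + 3 / 4 * real (max_degree V H) + 1"
    if "4 * chromatic_number V H \<le> clique_number V H + 3 * max_degree V H + 4" for H
    using of_nat_mono[OF that, where 'a = real] by simp
  ultimately show ?thesis by blast
qed

end
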